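(* Let $d\ge 2$ and $t\ge 2$ be fixed integers. For any non-degenerate quadratic form $Q$ on $\mathbb{F}_q^d$ and any set $\mathcal{E} \subset \mathbb{F}_q^d$, consider the system of $\binom{t}{2}$ equations $$Q(\boldsymbol{a}_i - \boldsymbol{a}_j) = \lambda_{ij}\quad(1\le i<j\le t), \qquad \boldsymbol{a}_i \in \mathcal{E},\ i=1,\ldots,t.$$ If $|\mathcal{E}| \gg q^{(d+t-1)/2}$, then this system is solvable for at least $(1-o(1)) q^{\binom{t}{2}}$ possible choices of $(\lambda_{ij})_{1\le i<j\le t}$ with $\lambda_{ij} \in \mathbb{F}_q$.
   Context: $q$ is a power of an odd prime, viewed as an asymptotic parameter: $q\to\infty$, the set $\mathcal{E}$ and the form $Q$ may depend on $q$, and $o(1)$ denotes a quantity tending to $0$ as $q\to\infty$. $X \ll Y$ (equivalently $Y \gg X$) means $X = o(Y)$. *)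

theory Defs
  imports Complex_Main "HOL-Algebra.Ring" "HOL-Library.FuncSet"
    "HOL-Library.Landau_Symbols" "HOL-Computational_Algebra.Primes"
begin

text \<open>
  The order of the field tends to infinity, so the field itself varies and cannot be a fixed type:
  fields are \<^locale>\<open>field\<close> records, and vectors over such a field are extensional functions
  on \<^term>\<open>{..<d}\<close>.
\<close>

definition vecs :: "('a, 'm) ring_scheme \<Rightarrow> nat \<Rightarrow> (nat \<Rightarrow> 'a) set" where
  "vecs K d = {..<d} \<rightarrow>\<^sub>E carrier K"

definition vzero :: "('a, 'm) ring_scheme \<Rightarrow> nat \<Rightarrow> nat \<Rightarrow> 'a" where
  "vzero K d = (\<lambda>k\<in>{..<d}. \<zero>\<^bsub>K\<^esub>)"

definition vadd :: "('a, 'm) ring_scheme \<Rightarrow> nat \<Rightarrow> (nat \<Rightarrow> 'a) \<Rightarrow> (nat \<Rightarrow> 'a) \<Rightarrow> nat \<Rightarrow> 'a" where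
  "vadd K d x y = (\<lambda>k\<in>{..<d}. x k \<oplus>\<^bsub>K\<^esub> y k)"

definition vdiff :: "('a, 'm) ring_scheme \<Rightarrow> nat \<Rightarrow> (nat \<Rightarrow> 'a) \<Rightarrow> (nat \<Rightarrow> 'a) \<Rightarrow> nat \<Rightarrow> 'a" where
  "vdiff K d x y = (\<lambda>k\<in>{..<d}. x k \<ominus>\<^bsub>K\<^esub> y k)"

definition quadratic_form ::
    "('a, 'm) ring_scheme \<Rightarrow> nat \<Rightarrow> ((nat \<Rightarrow> 'a) \<Rightarrow> 'a) \<Rightarrow> bool" where
  "quadratic_form K d Q \<longleftrightarrow>
     (\<exists>c :: nat \<Rightarrow> nat \<Rightarrow> 'a. (\<forall>i<d. \<forall>j<d. c i j \<in> carrier K) \<and>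
        (\<forall>x\<in>vecs K d.
           Q x = (\<Oplus>\<^bsub>K\<^esub>j\<in>{..<d}. \<Oplus>\<^bsub>K\<^esub>i\<in>{..j}. c i j \<otimes>\<^bsub>K\<^esub> (x i \<otimes>\<^bsub>K\<^esub> x j))))"

definition polar_form ::
    "('a, 'm) ring_scheme \<Rightarrow> nat \<Rightarrow> ((nat \<Rightarrow> 'a) \<Rightarrow> 'a) \<Rightarrow> (nat \<Rightarrow> 'a) \<Rightarrow> (nat \<Rightarrow> 'a) \<Rightarrow> 'a" where
  "polar_form K d Q x y = Q (vadd K d x y) \<ominus>\<^bsub>K\<^esub> Q x \<ominus>\<^bsub>K\<^esub> Q y"

text \<open>
  The polar form is twice the symmetric bilinear form with diagonal \<open>Q\<close>; in odd
  characteristic both have the same radical.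
\<close>

definition nondegenerate_quadratic_form ::
    "('a, 'm) ring_scheme \<Rightarrow> nat \<Rightarrow> ((nat \<Rightarrow> 'a) \<Rightarrow> 'a) \<Rightarrow> bool" where
  "nondegenerate_quadratic_form K d Q \<longleftrightarrow> quadratic_form K d Q \<and>
     (\<forall>x\<in>vecs K d. (\<forall>y\<in>vecs K d. polar_form K d Q x y = \<zero>\<^bsub>K\<^esub>) \<longrightarrow> x = vzero K d)"

definition index_pairs :: "nat \<Rightarrow> (nat \<times> nat) set" where
  "index_pairs t = {(i, j). 1 \<le> i \<and> i < j \<and> j \<le> t}"

definition solvable ::
    "('a, 'm) ring_scheme \<Rightarrow> nat \<Rightarrow> nat \<Rightarrow> ((nat \<Rightarrow> 'a) \<Rightarrow> 'a) \<Rightarrow> (nat \<Rightarrow> 'a) set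
      \<Rightarrow> (nat \<times> nat \<Rightarrow> 'a) \<Rightarrow> bool" where
  "solvable K d t Q E l \<longleftrightarrow>
     (\<exists>a. (\<forall>i\<in>{1..t}. a i \<in> E) \<and>
        (\<forall>(i, j)\<in>index_pairs t. Q (vdiff K d (a i) (a j)) = l (i, j)))"

definition solvable_systems ::
    "('a, 'm) ring_scheme \<Rightarrow> nat \<Rightarrow> nat \<Rightarrow> ((nat \<Rightarrow> 'a) \<Rightarrow> 'a) \<Rightarrow> (nat \<Rightarrow> 'a) set
      \<Rightarrow> (nat \<times> nat \<Rightarrow> 'a) set" where
  "solvable_systems K d t Q E =
     {l \<in> index_pairs t \<rightarrow>\<^sub>E carrier K. solvable K d t Q E l}"

end

theory Submission
  imports Defs "HOL-Analysis.Convex" "HOL-Algebra.Multiplicative_Group"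
begin

text \<open>
  Choose \<open>a\<^sub>1, \<dots>, a\<^sub>t\<close> independently and uniformly from \<open>E\<close>. The vector of values
  \<open>Q (a\<^sub>i - a\<^sub>j)\<close> for \<open>i < j\<close>, the colouring of the tuple, turns out to be almost uniformly
  distributed over all assignments of field elements to pairs, in \<open>L\<^sup>1\<close> distance. An unsolvable system is a colouring of
  probability zero, hence contributes its full uniform weight to that distance, so the distance
  bounds the proportion of unsolvable systems (\<open>card_solvable_systems_ge\<close>).

  The distance is bounded by a chain rule (\<open>L1_discrepancy_chain\<close>): passing from \<open>k\<close> to \<open>k + 1\<close>
  points costs the average over \<open>a\<^sub>1, \<dots>, a\<^sub>k\<close> of the distance between uniform measure and the
  law of the \<open>k\<close> new values \<open>Q (a\<^sub>i - x)\<close>, where \<open>x\<close> is random in \<open>E\<close>. By Cauchy-Schwarz this is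
  controlled by the number of coincidences, that is by the sum over \<open>x, y \<in> E\<close> of \<open>f(x,y)\<^sup>k\<close>, where
  \<open>f(x,y)\<close> counts the points of \<open>E\<close> that are equidistant from \<open>x\<close> and \<open>y\<close>. What is needed is that
  \<open>f(x,y)\<close> is close to \<open>|E|/q\<close> for most pairs.

  The only geometric input is that for \<open>a \<noteq> b\<close> the function \<open>u \<mapsto> Q (a - u) - Q (b - u)\<close> is affine
  and not constant, so that it takes each value equally often (\<open>card_bisector\<close>). Therefore,
  for \<open>u\<close> uniform in the whole space, families of random variables indexed by \<open>E\<close> and built from
  \<open>Q\<close> are pairwise equidistributed, and second moments can be computed exactly. This is used twice:
  randomising the centre \<open>a\<close> over the whole space bounds the mean of \<open>f/|E| - 1/q\<close>, and
  randomising \<open>y\<close> for a fixed \<open>x\<close> bounds its mean square; the sums over \<open>E \<times> E\<close> of this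
  quantity and of its square are both at most \<open>q\<^sup>d\<close>. Passing from \<open>E\<close> to the whole space is
  legitimate in either case because the sums that are extended consist of squares. Since \<open>0 \<le> f/|E| \<le> 1\<close>, a second order Taylor bound for the \<open>k\<close>-th power
  combines both estimates into a relative error of at most \<open>2 k\<^sup>2 q\<^bsup>d+k\<^esup> / |E|\<^sup>2\<close>.

  Taking square roots and adding up over \<open>k < t\<close>, the proportion of unsolvable systems is at most
  \<open>2 t\<^sup>2 q\<^bsup>(d+t-1)/2\<^esup> / |E|\<close>, which tends to zero under the assumption on \<open>E\<close>.
\<close>

section \<open>Variance of fibre sizes\<close>

text \<open>
  Both sides count the pairs of elements of \<open>E\<close> with the same value.
\<close>

lemma sum_card_fibres_squared:
  fixes f :: "'x \<Rightarrow> 'c"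
  assumes "finite E" "finite C" "f ` E \<subseteq> C"
  shows "(\<Sum>c\<in>C. (card {x \<in> E. f x = c})\<^sup>2) = (\<Sum>x\<in>E. card {y \<in> E. f x = f y})"
proof -
  have "(\<Sum>x\<in>E. card {y \<in> E. f x = f y})
      = (\<Sum>c\<in>C. \<Sum>x\<in>{x \<in> E. f x = c}. card {y \<in> E. f x = f y})"
    using sum.group[OF assms, of "\<lambda>x. card {y \<in> E. f x = f y}"] by simp
  also have "\<dots> = (\<Sum>c\<in>C. \<Sum>x\<in>{x \<in> E. f x = c}. card {y \<in> E. f y = c})"
    by (intro sum.cong refl arg_cong[where f = card]) auto
  finally show ?thesis by (simp add: power2_eq_square)
qed

lemma fibre_variance:
  fixes f :: "'x \<Rightarrow> 'c"
  assumes "finite E" "finite C" "f ` E \<subseteq> C"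
  shows "(\<Sum>c\<in>C. (real (card {x \<in> E. f x = c}) - card E / card C)\<^sup>2)
       = real (\<Sum>x\<in>E. card {y \<in> E. f x = f y}) - (card E)\<^sup>2 / card C"
proof (cases "C = {}")
  case False
  then have C: "real (card C) > 0" using assms(2) by (simp add: card_gt_0_iff)
  have "(\<Sum>c\<in>C. card {x \<in> E. f x = c}) = card E"
    using sum.group[OF assms, of "\<lambda>_. 1::nat"] by simp
  then have s: "(\<Sum>c\<in>C. real (card {x \<in> E. f x = c})) = card E"
    by (metis of_nat_sum)
  have "(\<Sum>c\<in>C. (real (card {x \<in> E. f x = c}) - card E / card C)\<^sup>2)
      = (\<Sum>c\<in>C. (real (card {x \<in> E. f x = c}))\<^sup>2)
        - 2 * (card E / card C) * (\<Sum>c\<in>C. real (card {x \<in> E. f x = c}))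
        + card C * (card E / card C)\<^sup>2"
    by (simp add: power2_diff sum.distrib sum_subtractf sum_distrib_left algebra_simps)
  also have "(\<Sum>c\<in>C. (real (card {x \<in> E. f x = c}))\<^sup>2) = real (\<Sum>x\<in>E. card {y \<in> E. f x = f y})"
    by (simp flip: sum_card_fibres_squared[OF assms])
  finally show ?thesis using C by (simp add: s field_simps power2_eq_square)
qed (use assms in auto)

text \<open>
  The coincidence hypothesis says that, for random \<open>u\<close>, two distinct members of the family
  \<open>R x\<close> agree as often as independent uniform variables would. As for sums of pairwise independent
  variables, all off-diagonal terms of the second moment cancel, and only the
  \<^term>\<open>card E * card U\<close> diagonal pairs contribute.
\<close>

lemma pairwise_independent_variance:
  fixes R :: "'x \<Rightarrow> 'u \<Rightarrow> 'c"
  assumes fin: "finite E" "finite U" "finite C" and ne: "C \<noteq> {}"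
    and R: "\<And>x u. x \<in> E \<Longrightarrow> u \<in> U \<Longrightarrow> R x u \<in> C"
    and coll: "\<And>x y. x \<in> E \<Longrightarrow> y \<in> E \<Longrightarrow> x \<noteq> y \<Longrightarrow>
                 card {u \<in> U. R x u = R y u} * card C = card U"
  shows "(\<Sum>u\<in>U. \<Sum>c\<in>C. (real (card {x \<in> E. R x u = c}) - card E / card C)\<^sup>2)
       \<le> real (card E) * card U"
proof -
  have C: "real (card C) > 0" using fin ne by (simp add: card_gt_0_iff)
  have coll': "real (card {u \<in> U. R x u = R y u}) = card U / card C + (if x = y then card U - card U / card C else 0)"
    if "x \<in> E" "y \<in> E" for x y
  proof (cases "x = y")
    case False
    have "real (card {u \<in> U. R x u = R y u}) * card C = card U"
      using coll[OF that False] by (metis of_nat_mult)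
    then show ?thesis using C False by (simp add: field_simps)
  qed simp
  have "(\<Sum>u\<in>U. \<Sum>c\<in>C. (real (card {x \<in> E. R x u = c}) - card E / card C)\<^sup>2)
      = (\<Sum>u\<in>U. real (\<Sum>x\<in>E. card {y \<in> E. R x u = R y u}) - (card E)\<^sup>2 / card C)"
    by (intro sum.cong refl fibre_variance) (use fin R in auto)
  also have "\<dots> = (\<Sum>u\<in>U. \<Sum>x\<in>E. \<Sum>y\<in>E. of_bool (R x u = R y u)) - card U * ((card E)\<^sup>2 / card C)"
    using fin by (simp add: sum_subtractf of_bool_def sum.If_cases Int_def)
  also have "(\<Sum>u\<in>U. \<Sum>x\<in>E. \<Sum>y\<in>E. of_bool (R x u = R y u))
      = (\<Sum>x\<in>E. \<Sum>y\<in>E. \<Sum>u\<in>U. of_bool (R x u = R y u) :: real)"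
    by (subst sum.swap, rule sum.cong[OF refl], subst sum.swap) rule
  also have "\<dots> = (\<Sum>x\<in>E. \<Sum>y\<in>E. real (card {u \<in> U. R x u = R y u}))"
    using fin by (simp add: of_bool_def sum.If_cases Int_def)
  also have "\<dots> = (\<Sum>x\<in>E. \<Sum>y\<in>E. card U / card C + (if x = y then card U - card U / card C else 0))"
    by (intro sum.cong refl coll')
  also have "\<dots> = (card E)\<^sup>2 * (card U / card C) + card E * (card U - card U / card C)"
    using fin by (simp add: sum.distrib power2_eq_square distrib_left)
  finally have "(\<Sum>u\<in>U. \<Sum>c\<in>C. (real (card {x \<in> E. R x u = c}) - card E / card C)\<^sup>2)
      = real (card E) * card U - real (card E) * card U / card C"
    by (simp add: algebra_simps)
  moreover have "0 \<le> real (card E) * card U / card C" by simp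
  ultimately show ?thesis by linarith
qed

text \<open>
  In the induction step \<open>f = m + (f - m)\<close> multiplies the first two terms, and \<open>f \<le> 1\<close> the last one.
  The first order term keeps its sign because it is later summed over pairs of points: its
  absolute value, estimated from the sum of squares by Cauchy-Schwarz, would be too large
  for \<open>k = 1\<close>.
\<close>

lemma power_taylor_bound:
  fixes f m :: real
  assumes "0 \<le> f" "f \<le> 1" "0 \<le> m" "m \<le> 1"
  shows "f ^ k \<le> m ^ k + k * m ^ (k - 1) * (f - m) + k\<^sup>2 * (f - m)\<^sup>2"
proof (induction k)
  case (Suc k)
  have m1: "m ^ (k-1) \<le> 1" using assms by (simp add: power_le_one)
  have "f ^ Suc k \<le> f * (m ^ k + k * m ^ (k - 1) * (f - m) + k\<^sup>2 * (f - m)\<^sup>2)"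
    using Suc assms by (simp add: mult_left_mono)
  also have "\<dots> = m ^ Suc k + Suc k * m ^ k * (f - m) + (k * m ^ (k - 1) + k\<^sup>2 * f) * (f - m)\<^sup>2"
    by (cases k) (simp_all add: algebra_simps power2_eq_square)
  also have "\<dots> \<le> m ^ Suc k + Suc k * m ^ k * (f - m) + (Suc k)\<^sup>2 * (f - m)\<^sup>2"
  proof -
    have "k * m ^ (k - 1) \<le> k" "k\<^sup>2 * f \<le> k\<^sup>2"
      using m1 assms by (auto intro!: mult_left_le)
    then have "k * m ^ (k - 1) + k\<^sup>2 * f \<le> (Suc k)\<^sup>2"
      by (simp add: power2_eq_square algebra_simps)
    then show ?thesis by (simp add: mult_right_mono)
  qed
  finally show ?case by simp
qed simp

text \<open>
  The joint law of \<open>(f a, g a x)\<close> is compared with the uniform law on \<open>L \<times> M\<close> through the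
  intermediate law that draws \<open>f a\<close> correctly and the second component uniformly.
\<close>

lemma L1_discrepancy_chain:
  fixes f :: "'x \<Rightarrow> 'l" and g :: "'x \<Rightarrow> 'y \<Rightarrow> 'm"
  assumes fin: "finite X" "finite Y" "finite L" "finite M" and f: "f ` X \<subseteq> L"
  shows "(\<Sum>(l, m)\<in>L \<times> M. \<bar>card {(a, x) \<in> X \<times> Y. f a = l \<and> g a x = m} / (real (card X) * card Y)
             - 1 / (real (card L) * card M)\<bar>)
       \<le> (\<Sum>l\<in>L. \<bar>card {a \<in> X. f a = l} / card X - 1 / card L\<bar>)
         + (\<Sum>a\<in>X. \<Sum>m\<in>M. \<bar>card {x \<in> Y. g a x = m} / card Y - 1 / card M\<bar>) / card X"
    (is "?lhs \<le> ?A + ?B")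
proof -
  let ?n = "\<lambda>a m. card {x \<in> Y. g a x = m} / card Y - 1 / card M"
  let ?u = "\<lambda>l. card {a \<in> X. f a = l} / card X - 1 / card L"
  have split: "card {(a, x) \<in> X \<times> Y. f a = l \<and> g a x = m} / (real (card X) * card Y)
             - 1 / (real (card L) * card M)
      = (\<Sum>a\<in>{a \<in> X. f a = l}. ?n a m) / card X + ?u l / card M" for l m
  proof -
    have "{(a, x) \<in> X \<times> Y. f a = l \<and> g a x = m} = Sigma {a \<in> X. f a = l} (\<lambda>a. {x \<in> Y. g a x = m})"
      by auto
    then have "card {(a, x) \<in> X \<times> Y. f a = l \<and> g a x = m}
        = (\<Sum>a\<in>{a \<in> X. f a = l}. card {x \<in> Y. g a x = m})"
      using fin by simp
    then show ?thesis
      by (simp add: sum_subtractf sum_divide_distrib diff_divide_distrib field_simps)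
  qed
  have "?lhs = (\<Sum>l\<in>L. \<Sum>m\<in>M. \<bar>(\<Sum>a\<in>{a \<in> X. f a = l}. ?n a m) / card X + ?u l / card M\<bar>)"
    by (simp only: split sum.cartesian_product)
  also have "\<dots> \<le> (\<Sum>l\<in>L. \<Sum>m\<in>M. (\<Sum>a\<in>{a \<in> X. f a = l}. \<bar>?n a m\<bar>) / card X + \<bar>?u l\<bar> / card M)"
  proof (intro sum_mono)
    fix l m
    have "\<bar>(\<Sum>a\<in>{a \<in> X. f a = l}. ?n a m) / card X\<bar> \<le> (\<Sum>a\<in>{a \<in> X. f a = l}. \<bar>?n a m\<bar>) / card X"
      by (simp add: sum_abs divide_right_mono)
    moreover have "\<bar>?u l / card M\<bar> = \<bar>?u l\<bar> / card M" by simp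
    ultimately show "\<bar>(\<Sum>a\<in>{a \<in> X. f a = l}. ?n a m) / card X + ?u l / card M\<bar>
        \<le> (\<Sum>a\<in>{a \<in> X. f a = l}. \<bar>?n a m\<bar>) / card X + \<bar>?u l\<bar> / card M"
      by linarith
  qed
  also have "\<dots> = (\<Sum>l\<in>L. \<Sum>m\<in>M. \<Sum>a\<in>{a \<in> X. f a = l}. \<bar>?n a m\<bar>) / card X
      + (\<Sum>l\<in>L. card M * (\<bar>?u l\<bar> / card M))"
    by (simp add: sum.distrib sum_divide_distrib)
  also have "(\<Sum>l\<in>L. \<Sum>m\<in>M. \<Sum>a\<in>{a \<in> X. f a = l}. \<bar>?n a m\<bar>)
      = (\<Sum>l\<in>L. \<Sum>a\<in>{a \<in> X. f a = l}. \<Sum>m\<in>M. \<bar>?n a m\<bar>)"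
    by (intro sum.cong refl sum.swap)
  also have "\<dots> = (\<Sum>a\<in>X. \<Sum>m\<in>M. \<bar>?n a m\<bar>)"
    by (rule sum.group[OF fin(1,3) f])
  also have "(\<Sum>l\<in>L. card M * (\<bar>?u l\<bar> / card M)) \<le> ?A"
    by (intro sum_mono) (cases "card M = 0"; simp)
  finally show ?thesis by simp
qed

section \<open>Quadratic forms over finite fields\<close>

lemma vec_closed: "x \<in> vecs K d \<Longrightarrow> i < d \<Longrightarrow> x i \<in> carrier K"
  by (auto simp: vecs_def)

lemma vec_eqI: "x \<in> vecs K d \<Longrightarrow> y \<in> vecs K d \<Longrightarrow> (\<And>i. i < d \<Longrightarrow> x i = y i) \<Longrightarrow> x = y"
  by (auto simp: vecs_def intro: PiE_ext)

definition vsmult :: "('a, 'm) ring_scheme \<Rightarrow> nat \<Rightarrow> 'a \<Rightarrow> (nat \<Rightarrow> 'a) \<Rightarrow> nat \<Rightarrow> 'a" where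
  "vsmult K d s x = (\<lambda>k\<in>{..<d}. s \<otimes>\<^bsub>K\<^esub> x k)"

text \<open>
  The bilinear form with upper triangular Gram matrix \<open>c\<close>. It need not be symmetric; its diagonal
  \<open>x = y\<close> is the general quadratic form.
\<close>

definition bilin :: "('a, 'm) ring_scheme \<Rightarrow> nat \<Rightarrow> (nat \<Rightarrow> nat \<Rightarrow> 'a) \<Rightarrow> (nat \<Rightarrow> 'a) \<Rightarrow> (nat \<Rightarrow> 'a) \<Rightarrow> 'a" where
  "bilin K d c x y =
     (\<Oplus>\<^bsub>K\<^esub>j\<in>{..<d}. \<Oplus>\<^bsub>K\<^esub>i\<in>{..j}. c i j \<otimes>\<^bsub>K\<^esub> (x i \<otimes>\<^bsub>K\<^esub> y j))"

context cring
begin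

lemma vadd_closed: "x \<in> vecs R d \<Longrightarrow> y \<in> vecs R d \<Longrightarrow> vadd R d x y \<in> vecs R d"
  by (auto simp: vadd_def vecs_def)

lemma vdiff_closed: "x \<in> vecs R d \<Longrightarrow> y \<in> vecs R d \<Longrightarrow> vdiff R d x y \<in> vecs R d"
  by (auto simp: vdiff_def vecs_def)

lemma vsmult_closed: "s \<in> carrier R \<Longrightarrow> x \<in> vecs R d \<Longrightarrow> vsmult R d s x \<in> vecs R d"
  by (auto simp: vsmult_def vecs_def)

context
  fixes c :: "nat \<Rightarrow> nat \<Rightarrow> 'a" and d :: nat
  assumes c: "\<And>i j. i < d \<Longrightarrow> j < d \<Longrightarrow> c i j \<in> carrier R"
begin

lemma bilin_closed: "x \<in> vecs R d \<Longrightarrow> y \<in> vecs R d \<Longrightarrow> bilin R d c x y \<in> carrier R"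
  unfolding bilin_def by (intro finsum_closed Pi_I) (auto simp: c vec_closed)

lemma bilin_vadd_left:
  assumes "x \<in> vecs R d" "x' \<in> vecs R d" "y \<in> vecs R d"
  shows "bilin R d c (vadd R d x x') y = bilin R d c x y \<oplus> bilin R d c x' y"
proof -
  have "bilin R d c (vadd R d x x') y = (\<Oplus>j\<in>{..<d}. (\<Oplus>i\<in>{..j}. c i j \<otimes> (x i \<otimes> y j)) \<oplus> (\<Oplus>i\<in>{..j}. c i j \<otimes> (x' i \<otimes> y j)))"
    unfolding bilin_def
  proof (intro finsum_cong' refl)
    fix j assume j: "j \<in> {..<d}"
    have "(\<Oplus>i\<in>{..j}. c i j \<otimes> (vadd R d x x' i \<otimes> y j)) = (\<Oplus>i\<in>{..j}. c i j \<otimes> (x i \<otimes> y j) \<oplus> c i j \<otimes> (x' i \<otimes> y j))"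
      using j assms by (intro finsum_cong' refl) (auto simp: vadd_def c vec_closed l_distr r_distr)
    then show "(\<Oplus>i\<in>{..j}. c i j \<otimes> (vadd R d x x' i \<otimes> y j)) = (\<Oplus>i\<in>{..j}. c i j \<otimes> (x i \<otimes> y j)) \<oplus> (\<Oplus>i\<in>{..j}. c i j \<otimes> (x' i \<otimes> y j))"
      using j assms by (simp add: finsum_addf Pi_def c vec_closed)
  qed (use assms in \<open>auto simp: c vec_closed intro!: finsum_closed a_closed\<close>)
  then show ?thesis
    unfolding bilin_def using assms by (simp add: finsum_addf Pi_def c vec_closed)
qed

lemma bilin_vadd_right:
  assumes "x \<in> vecs R d" "y \<in> vecs R d" "y' \<in> vecs R d"
  shows "bilin R d c x (vadd R d y y') = bilin R d c x y \<oplus> bilin R d c x y'"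
proof -
  have "bilin R d c x (vadd R d y y') = (\<Oplus>j\<in>{..<d}. (\<Oplus>i\<in>{..j}. c i j \<otimes> (x i \<otimes> y j)) \<oplus> (\<Oplus>i\<in>{..j}. c i j \<otimes> (x i \<otimes> y' j)))"
    unfolding bilin_def
  proof (intro finsum_cong' refl)
    fix j assume j: "j \<in> {..<d}"
    have "(\<Oplus>i\<in>{..j}. c i j \<otimes> (x i \<otimes> vadd R d y y' j)) = (\<Oplus>i\<in>{..j}. c i j \<otimes> (x i \<otimes> y j) \<oplus> c i j \<otimes> (x i \<otimes> y' j))"
      using j assms by (intro finsum_cong' refl) (auto simp: vadd_def c vec_closed l_distr r_distr)
    then show "(\<Oplus>i\<in>{..j}. c i j \<otimes> (x i \<otimes> vadd R d y y' j)) = (\<Oplus>i\<in>{..j}. c i j \<otimes> (x i \<otimes> y j)) \<oplus> (\<Oplus>i\<in>{..j}. c i j \<otimes> (x i \<otimes> y' j))"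
      using j assms by (simp add: finsum_addf Pi_def c vec_closed)
  qed (use assms in \<open>auto simp: c vec_closed intro!: finsum_closed a_closed\<close>)
  then show ?thesis
    unfolding bilin_def using assms by (simp add: finsum_addf Pi_def c vec_closed)
qed

lemma bilin_vsmult_left:
  assumes "s \<in> carrier R" "x \<in> vecs R d" "y \<in> vecs R d"
  shows "bilin R d c (vsmult R d s x) y = s \<otimes> bilin R d c x y"
proof -
  have "bilin R d c (vsmult R d s x) y = (\<Oplus>j\<in>{..<d}. s \<otimes> (\<Oplus>i\<in>{..j}. c i j \<otimes> (x i \<otimes> y j)))"
    unfolding bilin_def
  proof (intro finsum_cong' refl)
    fix j assume j: "j \<in> {..<d}"
    have "(\<Oplus>i\<in>{..j}. c i j \<otimes> (vsmult R d s x i \<otimes> y j)) = (\<Oplus>i\<in>{..j}. s \<otimes> (c i j \<otimes> (x i \<otimes> y j)))"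
      using j assms by (intro finsum_cong' refl) (auto simp: vsmult_def c vec_closed m_ac)
    then show "(\<Oplus>i\<in>{..j}. c i j \<otimes> (vsmult R d s x i \<otimes> y j)) = s \<otimes> (\<Oplus>i\<in>{..j}. c i j \<otimes> (x i \<otimes> y j))"
      using j assms by (simp add: finsum_rdistr Pi_def c vec_closed)
  qed (use assms in \<open>auto simp: c vec_closed intro!: finsum_closed m_closed\<close>)
  then show ?thesis
    unfolding bilin_def using assms by (simp add: finsum_rdistr Pi_def c vec_closed)
qed

lemma bilin_vsmult_right:
  assumes "s \<in> carrier R" "x \<in> vecs R d" "y \<in> vecs R d"
  shows "bilin R d c x (vsmult R d s y) = s \<otimes> bilin R d c x y"
proof -
  have "bilin R d c x (vsmult R d s y) = bilin R d c (vsmult R d s x) y"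
    unfolding bilin_def
    using assms by (intro finsum_cong' refl) (auto simp: vsmult_def c vec_closed m_ac intro!: finsum_cong' finsum_closed)
  then show ?thesis using bilin_vsmult_left assms by simp
qed

end

end

locale finite_quadratic_space = field K for K :: "('a, 'm) ring_scheme" (structure) +
  fixes d :: nat and Q :: "(nat \<Rightarrow> 'a) \<Rightarrow> 'a"
  assumes finite_carrier: "finite (carrier K)"
    and nondegenerate: "nondegenerate_quadratic_form K d Q"
begin

lemma finite_vecs: "finite (vecs K d)"
  by (simp add: vecs_def finite_PiE finite_carrier)

lemma card_vecs: "card (vecs K d) = card (carrier K) ^ d"
  by (simp add: vecs_def card_funcsetE)

lemma vdiff_eq_iff:
  assumes "a \<in> vecs K d" "b \<in> vecs K d"
  shows "vdiff K d a b = vzero K d \<longleftrightarrow> a = b"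
proof
  assume z: "vdiff K d a b = vzero K d"
  show "a = b"
  proof (rule vec_eqI[OF assms])
    fix i assume "i < d"
    with fun_cong[OF z, of i] assms show "a i = b i"
      by (simp add: vdiff_def vzero_def vec_closed r_right_minus_eq)
  qed
qed (use assms in \<open>auto simp: vdiff_def vzero_def vec_closed\<close>)

text \<open>
  Packages all that is used about \<open>Q\<close>, so that later arguments need no coordinates: \<open>P\<close> is
  the polar form, written as the symmetrisation of the bilinear form behind \<open>Q\<close>.
\<close>

lemma form_expansion:
  obtains P where
    "\<And>x y. x \<in> vecs K d \<Longrightarrow> y \<in> vecs K d \<Longrightarrow> P x y \<in> carrier K"
    "\<And>x. x \<in> vecs K d \<Longrightarrow> Q x \<in> carrier K"
    "\<And>x y z. x \<in> vecs K d \<Longrightarrow> y \<in> vecs K d \<Longrightarrow> z \<in> vecs K d \<Longrightarrow> P (vadd K d x y) z = P x z \<oplus> P y z"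
    "\<And>x y s. x \<in> vecs K d \<Longrightarrow> y \<in> vecs K d \<Longrightarrow> s \<in> carrier K \<Longrightarrow> P x (vsmult K d s y) = s \<otimes> P x y"
    "\<And>x y s. x \<in> vecs K d \<Longrightarrow> y \<in> vecs K d \<Longrightarrow> s \<in> carrier K \<Longrightarrow>
        Q (vadd K d x (vsmult K d s y)) = Q x \<oplus> s \<otimes> P x y \<oplus> s \<otimes> s \<otimes> Q y"
    "\<And>x s. x \<in> vecs K d \<Longrightarrow> s \<in> carrier K \<Longrightarrow> Q (vsmult K d s x) = s \<otimes> s \<otimes> Q x"
    "\<And>x. x \<in> vecs K d \<Longrightarrow> x \<noteq> vzero K d \<Longrightarrow> \<exists>y\<in>vecs K d. P x y \<noteq> \<zero>"
proof -
  obtain c where c: "\<And>i j. i < d \<Longrightarrow> j < d \<Longrightarrow> c i j \<in> carrier K"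
    and Q: "\<And>x. x \<in> vecs K d \<Longrightarrow> Q x = bilin K d c x x"
    using nondegenerate
    unfolding nondegenerate_quadratic_form_def quadratic_form_def bilin_def by blast
  note T = bilin_closed[of d c] bilin_vadd_left[of d c] bilin_vadd_right[of d c]
    bilin_vsmult_left[of d c] bilin_vsmult_right[of d c]
  define P where "P = (\<lambda>x y. bilin K d c x y \<oplus> bilin K d c y x)"
  have polar: "polar_form K d Q x y = P x y" if "x \<in> vecs K d" "y \<in> vecs K d" for x y
  proof -
    let ?T = "bilin K d c"
    have cl: "?T x x \<in> carrier K" "?T x y \<in> carrier K" "?T y x \<in> carrier K" "?T y y \<in> carrier K"
      using that by (auto simp: T c)
    have "polar_form K d Q x y = (?T x x \<oplus> ?T y x) \<oplus> (?T x y \<oplus> ?T y y) \<ominus> ?T x x \<ominus> ?T y y"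
      using that by (simp add: polar_form_def Q T c vadd_closed)
    also have "\<dots> = ?T x y \<oplus> ?T y x" using cl by algebra
    finally show ?thesis by (simp add: P_def)
  qed
  show ?thesis
  proof (rule that[of P])
    fix x y assume xy: "x \<in> vecs K d" "y \<in> vecs K d"
    show "P x y \<in> carrier K" using xy by (simp add: P_def T c)
  next
    fix x assume x: "x \<in> vecs K d"
    show "Q x \<in> carrier K" using x by (simp add: Q T c)
  next
    fix x y z assume xyz: "x \<in> vecs K d" "y \<in> vecs K d" "z \<in> vecs K d"
    show "P (vadd K d x y) z = P x z \<oplus> P y z"
      using xyz by (simp add: P_def T c a_ac)
  next
    fix x y s assume xys: "x \<in> vecs K d" "y \<in> vecs K d" "s \<in> carrier K"
    show "P x (vsmult K d s y) = s \<otimes> P x y"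
      using xys by (simp add: P_def T c r_distr)
  next
    fix x y s assume xys: "x \<in> vecs K d" "y \<in> vecs K d" "s \<in> carrier K"
    let ?T = "bilin K d c"
    have cl: "?T x x \<in> carrier K" "?T x y \<in> carrier K" "?T y x \<in> carrier K" "?T y y \<in> carrier K"
      using xys by (auto simp: T c)
    have "Q (vadd K d x (vsmult K d s y))
        = (?T x x \<oplus> s \<otimes> ?T y x) \<oplus> (s \<otimes> ?T x y \<oplus> s \<otimes> (s \<otimes> ?T y y))"
      using xys by (simp add: Q T c vadd_closed vsmult_closed r_distr)
    also have "\<dots> = ?T x x \<oplus> s \<otimes> (?T x y \<oplus> ?T y x) \<oplus> s \<otimes> s \<otimes> ?T y y"
      using cl xys(3) by algebra
    finally show "Q (vadd K d x (vsmult K d s y)) = Q x \<oplus> s \<otimes> P x y \<oplus> s \<otimes> s \<otimes> Q y"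
      using xys by (simp add: Q P_def)
  next
    fix x s assume xs: "x \<in> vecs K d" "s \<in> carrier K"
    show "Q (vsmult K d s x) = s \<otimes> s \<otimes> Q x"
      using xs by (simp add: Q T c vsmult_closed m_assoc)
  next
    fix x assume "x \<in> vecs K d" "x \<noteq> vzero K d"
    then show "\<exists>y\<in>vecs K d. P x y \<noteq> \<zero>"
      using nondegenerate polar unfolding nondegenerate_quadratic_form_def by fastforce
  qed
qed

lemma form_closed: "x \<in> vecs K d \<Longrightarrow> Q x \<in> carrier K"
  by (rule form_expansion) blast

lemma form_vdiff_sym:
  assumes "x \<in> vecs K d" "y \<in> vecs K d"
  shows "Q (vdiff K d x y) = Q (vdiff K d y x)"
proof -
  obtain P where "\<And>x s. x \<in> vecs K d \<Longrightarrow> s \<in> carrier K \<Longrightarrow> Q (vsmult K d s x) = s \<otimes> s \<otimes> Q x"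
    by (rule form_expansion) blast
  from this[of "vdiff K d y x" "\<ominus> \<one>"]
  have "Q (vsmult K d (\<ominus> \<one>) (vdiff K d y x)) = Q (vdiff K d y x)"
    using assms by (simp add: vdiff_closed form_closed l_minus r_minus)
  moreover have "vsmult K d (\<ominus> \<one>) (vdiff K d y x) = vdiff K d x y"
  proof (rule vec_eqI[of _ K d])
    fix i assume i: "i < d"
    have "x i \<in> carrier K" "y i \<in> carrier K" using assms i by (auto simp: vec_closed)
    then show "vsmult K d (\<ominus> \<one>) (vdiff K d y x) i = vdiff K d x y i"
      using i by (simp add: vsmult_def vdiff_def) algebra
  qed (use assms in \<open>auto simp: vdiff_closed vsmult_closed\<close>)
  ultimately show ?thesis by simp
qed

section \<open>Bisectors\<close>

text \<open>
  The difference \<open>Q (a - u) - Q (b - u)\<close> is affine in \<open>u\<close>, because the quadratic parts cancel. Its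
  linear part is the polar form paired with \<open>b - a\<close>, which is nonzero by nondegeneracy, and \<open>w\<close> is a
  direction on which that linear part equals one.
\<close>

lemma bisector_shift:
  assumes "a \<in> vecs K d" "b \<in> vecs K d" "a \<noteq> b"
  shows "\<exists>w\<in>vecs K d. \<forall>u\<in>vecs K d. \<forall>s\<in>carrier K.
      Q (vdiff K d a (vadd K d u (vsmult K d s w))) \<ominus> Q (vdiff K d b (vadd K d u (vsmult K d s w)))
        = (Q (vdiff K d a u) \<ominus> Q (vdiff K d b u)) \<oplus> s"
proof -
  obtain P where P: "\<And>x y. x \<in> vecs K d \<Longrightarrow> y \<in> vecs K d \<Longrightarrow> P x y \<in> carrier K"
    and P_add: "\<And>x y z. x \<in> vecs K d \<Longrightarrow> y \<in> vecs K d \<Longrightarrow> z \<in> vecs K d \<Longrightarrow>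
                 P (vadd K d x y) z = P x z \<oplus> P y z"
    and P_smult: "\<And>x y s. x \<in> vecs K d \<Longrightarrow> y \<in> vecs K d \<Longrightarrow> s \<in> carrier K \<Longrightarrow>
                 P x (vsmult K d s y) = s \<otimes> P x y"
    and Q_add: "\<And>x y s. x \<in> vecs K d \<Longrightarrow> y \<in> vecs K d \<Longrightarrow> s \<in> carrier K \<Longrightarrow>
        Q (vadd K d x (vsmult K d s y)) = Q x \<oplus> s \<otimes> P x y \<oplus> s \<otimes> s \<otimes> Q y"
    and nd: "\<And>x. x \<in> vecs K d \<Longrightarrow> x \<noteq> vzero K d \<Longrightarrow> \<exists>y\<in>vecs K d. P x y \<noteq> \<zero>"
    by (rule form_expansion) blast
  let ?z = "vdiff K d b a"
  have z: "?z \<in> vecs K d" using assms by (simp add: vdiff_closed)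
  obtain y where y: "y \<in> vecs K d" "P ?z y \<noteq> \<zero>"
    using nd[OF z] assms vdiff_eq_iff by metis
  \<comment> \<open>Rescaled so that the pairing with \<open>b - a\<close> is one.\<close>
  define w where "w = vsmult K d (inv (P ?z y)) y"
  have unit: "P ?z y \<in> Units K" using y P[OF z y(1)] by (simp add: field_Units)
  have w: "w \<in> vecs K d" using y unit by (simp add: w_def vsmult_closed)
  have Pw: "P ?z w = \<one>" using y unit z by (simp add: w_def P_smult)
  show ?thesis
  proof (intro bexI[OF _ w] ballI)
    fix u s assume u: "u \<in> vecs K d" and s: "s \<in> carrier K"
    have shift: "vdiff K d a' (vadd K d u (vsmult K d s w))
        = vadd K d (vdiff K d a' u) (vsmult K d (\<ominus> s) w)" if a': "a' \<in> vecs K d" for a'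
    proof (rule vec_eqI[of _ K d])
      fix i assume i: "i < d"
      have "a' i \<in> carrier K" "u i \<in> carrier K" "w i \<in> carrier K"
        using a' u w i by (auto simp: vec_closed)
      then show "vdiff K d a' (vadd K d u (vsmult K d s w)) i
          = vadd K d (vdiff K d a' u) (vsmult K d (\<ominus> s) w) i"
        using i s by (simp add: vdiff_def vadd_def vsmult_def) algebra
    qed (use a' u w s in \<open>auto simp: vdiff_closed vsmult_closed vadd_closed\<close>)
    have Pb: "P (vdiff K d b u) w = \<one> \<oplus> P (vdiff K d a u) w"
    proof -
      have "vdiff K d b u = vadd K d ?z (vdiff K d a u)"
      proof (rule vec_eqI[of _ K d])
        fix i assume i: "i < d"
        have "a i \<in> carrier K" "b i \<in> carrier K" "u i \<in> carrier K"
          using assms u i by (auto simp: vec_closed)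
        then show "vdiff K d b u i = vadd K d ?z (vdiff K d a u) i"
          using i by (simp add: vdiff_def vadd_def) algebra
      qed (use assms u in \<open>auto simp: vdiff_closed vadd_closed\<close>)
      then show ?thesis using z assms u w Pw by (simp add: P_add vdiff_closed)
    qed
    have "Q (vdiff K d a u) \<in> carrier K" "Q (vdiff K d b u) \<in> carrier K"
      "Q w \<in> carrier K" "P (vdiff K d a u) w \<in> carrier K"
      using assms u w by (auto simp: form_closed vdiff_closed P)
    then show "Q (vdiff K d a (vadd K d u (vsmult K d s w)))
          \<ominus> Q (vdiff K d b (vadd K d u (vsmult K d s w)))
        = (Q (vdiff K d a u) \<ominus> Q (vdiff K d b u)) \<oplus> s"
      using s assms u w by (simp add: shift Q_add vdiff_closed Pb) algebra
  qed
qed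

text \<open>
  Translation by multiples of the vector from \<open>bisector_shift\<close> permutes the level sets
  transitively, so they all have the same size.
\<close>

lemma card_bisector:
  assumes "a \<in> vecs K d" "b \<in> vecs K d" "a \<noteq> b" "c \<in> carrier K"
  shows "card {u \<in> vecs K d. Q (vdiff K d a u) \<ominus> Q (vdiff K d b u) = c} * card (carrier K)
       = card (vecs K d)"
proof -
  define g where "g = (\<lambda>u. Q (vdiff K d a u) \<ominus> Q (vdiff K d b u))"
  have g: "g u \<in> carrier K" if "u \<in> vecs K d" for u
    using that assms by (simp add: g_def form_closed vdiff_closed)
  obtain w where w: "w \<in> vecs K d"
    and shift: "\<And>u s. u \<in> vecs K d \<Longrightarrow> s \<in> carrier K \<Longrightarrow> g (vadd K d u (vsmult K d s w)) = g u \<oplus> s"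
    using bisector_shift[OF assms(1-3)] unfolding g_def by blast
  have le: "card {u \<in> vecs K d. g u = c1} \<le> card {u \<in> vecs K d. g u = c2}"
    if c12: "c1 \<in> carrier K" "c2 \<in> carrier K" for c1 c2
  proof (rule card_inj_on_le)
    \<comment> \<open>Translation by this vector adds \<open>c2 - c1\<close> to \<open>g\<close>.\<close>
    let ?v = "vsmult K d (c2 \<ominus> c1) w"
    have v: "?v \<in> vecs K d" using w c12 by (simp add: vsmult_closed)
    show "inj_on (\<lambda>u. vadd K d u ?v) {u \<in> vecs K d. g u = c1}"
    proof (rule inj_onI)
      fix x y
      assume "x \<in> {u \<in> vecs K d. g u = c1}" "y \<in> {u \<in> vecs K d. g u = c1}"
        and "vadd K d x ?v = vadd K d y ?v"
      then have xy: "x \<in> vecs K d" "y \<in> vecs K d" "vadd K d x ?v = vadd K d y ?v" by auto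
      show "x = y"
      proof (rule vec_eqI[OF xy(1,2)])
        fix i assume i: "i < d"
        have "x i \<oplus> ?v i = y i \<oplus> ?v i" using fun_cong[OF xy(3), of i] i by (simp add: vadd_def)
        then show "x i = y i"
          using i xy v by (simp add: vec_closed)
      qed
    qed
    show "(\<lambda>u. vadd K d u ?v) ` {u \<in> vecs K d. g u = c1} \<subseteq> {u \<in> vecs K d. g u = c2}"
    proof clarify
      fix u assume u: "u \<in> vecs K d" "c1 = g u"
      have "g u \<oplus> (c2 \<ominus> g u) = c2" using g[OF u(1)] c12 by algebra
      then show "vadd K d u (vsmult K d (c2 \<ominus> g u) w) \<in> vecs K d \<and>
          g (vadd K d u (vsmult K d (c2 \<ominus> g u) w)) = c2"
        using u v g c12 shift[of u "c2 \<ominus> g u"] by (simp add: vadd_closed)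
    qed
  qed (simp add: finite_vecs)
  have "card (vecs K d) = (\<Sum>c'\<in>carrier K. card {u \<in> vecs K d. g u = c'})"
    using sum.group[OF finite_vecs finite_carrier, of g "\<lambda>_. 1::nat"] g by (simp add: image_subset_iff)
  also have "\<dots> = (\<Sum>c'\<in>carrier K. card {u \<in> vecs K d. g u = c})"
    using le assms(4) by (intro sum.cong refl antisym) auto
  finally show ?thesis by (simp add: g_def)
qed

end

section \<open>Points equidistant from two given points\<close>

context finite_quadratic_space
begin

abbreviation qdist :: "(nat \<Rightarrow> 'a) \<Rightarrow> (nat \<Rightarrow> 'a) \<Rightarrow> 'a" where
  "qdist x y \<equiv> Q (vdiff K d x y)"

abbreviation q :: nat where
  "q \<equiv> card (carrier K)"

text \<open>
  Colour each pair \<open>(a, x)\<close> by \<open>Q (a - x)\<close>. A point is counted here if it is joined to \<open>x\<close> and \<open>y\<close> by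
  edges of the same colour, whatever the colour.
\<close>

definition codegree :: "(nat \<Rightarrow> 'a) set \<Rightarrow> (nat \<Rightarrow> 'a) \<Rightarrow> (nat \<Rightarrow> 'a) \<Rightarrow> nat" where
  "codegree E x y = card {a \<in> E. qdist a x = qdist a y}"

lemma q_pos: "q > 0"
  using finite_carrier zero_closed by (auto simp: card_gt_0_iff)

lemma qdist_closed: "x \<in> vecs K d \<Longrightarrow> y \<in> vecs K d \<Longrightarrow> qdist x y \<in> carrier K"
  by (simp add: form_closed vdiff_closed)

lemma finite_subset_vecs: "E \<subseteq> vecs K d \<Longrightarrow> finite E"
  using finite_vecs finite_subset by blast

text \<open>
  The triples counted on the left are first sorted by the centre \<open>a\<close>. For each centre the excess over
  the main term is a sum of squares, so the centre may range over the whole space, where the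
  variables \<open>Q (a - x)\<close> are pairwise independent by \<open>card_bisector\<close>.
\<close>

lemma sum_codegree_le:
  assumes E: "E \<subseteq> vecs K d"
  shows "(\<Sum>x\<in>E. \<Sum>y\<in>E. real (codegree E x y))
       \<le> real (card E) ^ 3 / q + real (card E) * card (vecs K d)"
proof -
  let ?V = "vecs K d" and ?C = "carrier K"
  let ?Z = "\<lambda>a. \<Sum>c\<in>?C. (real (card {x \<in> E. qdist a x = c}) - card E / q)\<^sup>2"
  have fin: "finite E" using E by (rule finite_subset_vecs)
  have "(\<Sum>x\<in>E. \<Sum>y\<in>E. real (codegree E x y))
      = (\<Sum>x\<in>E. \<Sum>y\<in>E. \<Sum>a\<in>E. of_bool (qdist a x = qdist a y))"
    using fin by (simp add: codegree_def of_bool_def sum.If_cases Int_def)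
  also have "\<dots> = (\<Sum>a\<in>E. \<Sum>x\<in>E. \<Sum>y\<in>E. of_bool (qdist a x = qdist a y))"
    by (subst (2) sum.swap, subst sum.swap) rule
  also have "\<dots> = (\<Sum>a\<in>E. real (\<Sum>x\<in>E. card {y \<in> E. qdist a x = qdist a y}))"
    using fin by (simp add: of_bool_def sum.If_cases Int_def)
  also have "\<dots> = (\<Sum>a\<in>E. ?Z a + (card E)\<^sup>2 / q)"
  proof (rule sum.cong[OF refl])
    fix a assume "a \<in> E"
    then have "(\<lambda>x. qdist a x) ` E \<subseteq> ?C" using E qdist_closed by blast
    from fibre_variance[OF fin finite_carrier this]
    show "real (\<Sum>x\<in>E. card {y \<in> E. qdist a x = qdist a y}) = ?Z a + (card E)\<^sup>2 / q"
      by simp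
  qed
  also have "\<dots> = sum ?Z E + real (card E) ^ 3 / q"
    by (simp add: sum.distrib power3_eq_cube power2_eq_square)
  also have "sum ?Z E \<le> sum ?Z ?V"
    by (intro sum_mono2 finite_vecs E sum_nonneg) simp
  also have "sum ?Z ?V \<le> real (card E) * card ?V"
  proof (rule pairwise_independent_variance[OF fin finite_vecs finite_carrier])
    fix x y assume xy: "x \<in> E" "y \<in> E" "x \<noteq> y"
    have "{a \<in> ?V. qdist a x = qdist a y} = {a \<in> ?V. qdist x a \<ominus> qdist y a = \<zero>}"
      using xy E by (auto simp: r_right_minus_eq qdist_closed form_vdiff_sym[of x] form_vdiff_sym[of y] subsetD)
    then show "card {a \<in> ?V. qdist a x = qdist a y} * q = card ?V"
      using card_bisector[of x y \<zero>] xy E by auto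
  qed (use E qdist_closed in auto)
  finally show ?thesis by simp
qed

text \<open>
  For a fixed \<open>x\<close>, \<open>codegree E x y\<close> is the number of \<open>a \<in> E\<close> for which
  \<open>Q (a - x) - Q (a - y)\<close> vanishes. The square is bounded by the sum of the corresponding
  squares over all values of that difference and over all \<open>y\<close> in the space, where pairwise
  independence in \<open>y\<close> comes from \<open>card_bisector\<close>.
\<close>

lemma codegree_variance:
  assumes E: "E \<subseteq> vecs K d"
  shows "(\<Sum>x\<in>E. \<Sum>y\<in>E. (real (codegree E x y) - card E / q)\<^sup>2)
       \<le> (real (card E))\<^sup>2 * card (vecs K d)"
proof -
  let ?V = "vecs K d" and ?C = "carrier K"
  have fin: "finite E" using E by (rule finite_subset_vecs)
  have "(\<Sum>y\<in>E. (real (codegree E x y) - card E / q)\<^sup>2) \<le> real (card E) * card ?V"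
    if x: "x \<in> E" for x
  proof -
    let ?R = "\<lambda>a y. qdist a x \<ominus> qdist a y"
    let ?z = "\<lambda>y c. (real (card {a \<in> E. ?R a y = c}) - card E / q)\<^sup>2"
    have "(\<Sum>y\<in>E. (real (codegree E x y) - card E / q)\<^sup>2) = (\<Sum>y\<in>E. ?z y \<zero>)"
    proof (rule sum.cong[OF refl])
      fix y assume "y \<in> E"
      then have "{a \<in> E. qdist a x = qdist a y} = {a \<in> E. ?R a y = \<zero>}"
        using x E by (auto simp: r_right_minus_eq qdist_closed subsetD)
      then show "(real (codegree E x y) - card E / q)\<^sup>2 = ?z y \<zero>"
        by (simp add: codegree_def)
    qed
    also have "\<dots> \<le> (\<Sum>y\<in>?V. ?z y \<zero>)"
      by (intro sum_mono2 finite_vecs E) simp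
    also have "\<dots> \<le> (\<Sum>y\<in>?V. \<Sum>c\<in>?C. ?z y c)"
      by (intro sum_mono member_le_sum finite_carrier zero_closed) simp
    also have "\<dots> \<le> real (card E) * card ?V"
    proof (rule pairwise_independent_variance[OF fin finite_vecs finite_carrier])
      fix a b assume ab: "a \<in> E" "b \<in> E" "a \<noteq> b"
      have "?R a y = ?R b y \<longleftrightarrow> qdist a y \<ominus> qdist b y = qdist a x \<ominus> qdist b x"
        if "y \<in> ?V" for y
      proof -
        have cl: "qdist a y \<in> ?C" "qdist b y \<in> ?C" "qdist a x \<in> ?C" "qdist b x \<in> ?C"
          using ab x E that by (auto simp: qdist_closed subsetD)
        have "?R a y \<ominus> ?R b y = (qdist a x \<ominus> qdist b x) \<ominus> (qdist a y \<ominus> qdist b y)"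
          using cl by algebra
        then show ?thesis
          using cl r_right_minus_eq[of "?R a y" "?R b y"]
            r_right_minus_eq[of "qdist a x \<ominus> qdist b x" "qdist a y \<ominus> qdist b y"]
          by (simp del: r_right_minus_eq) metis
      qed
      then have "{y \<in> ?V. ?R a y = ?R b y}
          = {y \<in> ?V. qdist a y \<ominus> qdist b y = qdist a x \<ominus> qdist b x}"
        by blast
      moreover have "qdist a x \<ominus> qdist b x \<in> ?C"
        using ab x E by (auto simp: qdist_closed subsetD)
      ultimately show "card {y \<in> ?V. ?R a y = ?R b y} * q = card ?V"
        using card_bisector[of a b] ab E by auto
    qed (use E x qdist_closed in \<open>auto simp: subsetD\<close>)
    finally show ?thesis .
  qed
  then have "(\<Sum>x\<in>E. \<Sum>y\<in>E. (real (codegree E x y) - card E / q)\<^sup>2)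
      \<le> (\<Sum>x\<in>E. real (card E) * card ?V)"
    by (rule sum_mono)
  then show ?thesis by (simp add: power2_eq_square)
qed

text \<open>
  The main term is the value of the sum if \<open>codegree E x y = |E|/q\<close> throughout. Relative to it, the
  error is \<open>2 k\<^sup>2 q\<^bsup>d+k\<^esup> / |E|\<^sup>2\<close>, and the case \<open>k = t - 1\<close> is what requires \<open>|E|\<close> to be large compared
  with \<open>q\<^bsup>(d+t-1)/2\<^esup>\<close>.
\<close>

lemma sum_codegree_power_le:
  assumes E: "E \<subseteq> vecs K d" "E \<noteq> {}"
  shows "(\<Sum>x\<in>E. \<Sum>y\<in>E. real (codegree E x y) ^ k)
       \<le> real (card E) ^ k * ((real (card E))\<^sup>2 / q ^ k + 2 * k\<^sup>2 * card (vecs K d))"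
proof -
  let ?e = "real (card E)" and ?v = "real (card (vecs K d))" and ?m = "1 / real q"
  let ?f = "\<lambda>x y. real (codegree E x y) / ?e"
  have fin: "finite E" using E(1) by (rule finite_subset_vecs)
  have e: "?e > 0" using fin E(2) by (simp add: card_gt_0_iff)
  have q: "real q \<ge> 1" using q_pos by simp
  have f: "0 \<le> ?f x y" "?f x y \<le> 1" for x y
    using e fin by (auto simp: codegree_def intro!: card_mono)
  have m: "0 \<le> ?m" "?m \<le> 1" using q by auto
  have "(\<Sum>x\<in>E. \<Sum>y\<in>E. ?f x y - ?m) = (\<Sum>x\<in>E. \<Sum>y\<in>E. real (codegree E x y)) / ?e - ?e\<^sup>2 / q"
    by (simp add: sum_subtractf sum_divide_distrib power2_eq_square)
  also have "\<dots> \<le> (?e ^ 3 / q + ?e * ?v) / ?e - ?e\<^sup>2 / q"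
    using sum_codegree_le[OF E(1)] e by (simp add: divide_right_mono)
  also have "\<dots> = ?v" using e by (simp add: field_simps power3_eq_cube power2_eq_square)
  finally have lin: "(\<Sum>x\<in>E. \<Sum>y\<in>E. ?f x y - ?m) \<le> ?v" .
  have "(\<Sum>x\<in>E. \<Sum>y\<in>E. (?f x y - ?m)\<^sup>2) = (\<Sum>x\<in>E. \<Sum>y\<in>E. (real (codegree E x y) - ?e / q)\<^sup>2 / ?e\<^sup>2)"
    using e by (intro sum.cong refl) (simp add: field_simps flip: power_divide)
  also have "\<dots> = (\<Sum>x\<in>E. \<Sum>y\<in>E. (real (codegree E x y) - ?e / q)\<^sup>2) / ?e\<^sup>2"
    by (simp add: sum_divide_distrib)
  also have "\<dots> \<le> ?e\<^sup>2 * ?v / ?e\<^sup>2"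
    by (intro divide_right_mono codegree_variance E) simp
  finally have quad: "(\<Sum>x\<in>E. \<Sum>y\<in>E. (?f x y - ?m)\<^sup>2) \<le> ?v" using e by simp
  have "(\<Sum>x\<in>E. \<Sum>y\<in>E. ?f x y ^ k)
      \<le> (\<Sum>x\<in>E. \<Sum>y\<in>E. ?m ^ k + k * ?m ^ (k - 1) * (?f x y - ?m) + k\<^sup>2 * (?f x y - ?m)\<^sup>2)"
  proof (intro sum_mono)
    fix x y
    show "?f x y ^ k \<le> ?m ^ k + k * ?m ^ (k - 1) * (?f x y - ?m) + k\<^sup>2 * (?f x y - ?m)\<^sup>2"
      using power_taylor_bound[OF f(1)[of x y] f(2)[of x y] m, of k] by simp
  qed
  also have "\<dots> = ?e\<^sup>2 * ?m ^ k + k * ?m ^ (k - 1) * (\<Sum>x\<in>E. \<Sum>y\<in>E. ?f x y - ?m)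
        + k\<^sup>2 * (\<Sum>x\<in>E. \<Sum>y\<in>E. (?f x y - ?m)\<^sup>2)"
    by (simp only: sum.distrib sum_distrib_left) (simp add: power2_eq_square)
  also have "\<dots> \<le> ?e\<^sup>2 * ?m ^ k + k * ?m ^ (k - 1) * ?v + k\<^sup>2 * ?v"
    using lin quad m by (intro add_mono mult_left_mono) auto
  also have "\<dots> \<le> ?e\<^sup>2 * ?m ^ k + k\<^sup>2 * ?v + k\<^sup>2 * ?v"
  proof -
    have "real k * ?m ^ (k - 1) \<le> real k" using m by (intro mult_left_le power_le_one) auto
    also have "\<dots> \<le> real (k\<^sup>2)" by (cases k) (auto simp: power2_eq_square)
    finally have "real k * ?m ^ (k - 1) * ?v \<le> real (k\<^sup>2) * ?v"
      by (rule mult_right_mono) simp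
    then show ?thesis by linarith
  qed
  finally have main: "(\<Sum>x\<in>E. \<Sum>y\<in>E. ?f x y ^ k) \<le> ?e\<^sup>2 / q ^ k + 2 * k\<^sup>2 * ?v"
    by (simp add: power_divide mult_ac add_ac)
  have "(\<Sum>x\<in>E. \<Sum>y\<in>E. real (codegree E x y) ^ k) = ?e ^ k * (\<Sum>x\<in>E. \<Sum>y\<in>E. ?f x y ^ k)"
    using e by (simp add: sum_distrib_left power_divide)
  also have "\<dots> \<le> ?e ^ k * (?e\<^sup>2 / q ^ k + 2 * k\<^sup>2 * ?v)"
    using main e by (intro mult_left_mono) auto
  finally show ?thesis by simp
qed

end

section \<open>Colourings of tuples\<close>

lemma index_pairs_0: "index_pairs 0 = {}"
  by (auto simp: index_pairs_def)

lemma index_pairs_Suc: "index_pairs (Suc t) = index_pairs t \<union> (\<lambda>i. (i, Suc t)) ` {1..t}"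
  by (auto simp: index_pairs_def)

lemma finite_index_pairs: "finite (index_pairs t)"
  by (induction t) (simp_all add: index_pairs_0 index_pairs_Suc)

lemma card_index_pairs_Suc: "card (index_pairs (Suc t)) = card (index_pairs t) + t"
proof -
  have "index_pairs t \<inter> (\<lambda>i. (i, Suc t)) ` {1..t} = {}" by (auto simp: index_pairs_def)
  then show ?thesis
    by (simp add: index_pairs_Suc card_Un_disjoint finite_index_pairs card_image inj_on_def)
qed

lemma card_index_pairs: "card (index_pairs t) = t choose 2"
  by (induction t) (simp_all add: index_pairs_0 card_index_pairs_Suc numeral_2_eq_2)

context finite_quadratic_space
begin

definition dist_colouring :: "nat \<Rightarrow> (nat \<Rightarrow> nat \<Rightarrow> 'a) \<Rightarrow> nat \<times> nat \<Rightarrow> 'a" where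
  "dist_colouring t a = (\<lambda>(i, j)\<in>index_pairs t. qdist (a i) (a j))"

definition dists_to :: "nat \<Rightarrow> (nat \<Rightarrow> nat \<Rightarrow> 'a) \<Rightarrow> (nat \<Rightarrow> 'a) \<Rightarrow> nat \<Rightarrow> 'a" where
  "dists_to t a x = (\<lambda>i\<in>{1..t}. qdist (a i) x)"

text \<open>
  The \<open>L\<^sup>1\<close> distance, which is twice the total variation distance, between the law of the colouring of
  a uniformly random tuple in \<open>E\<close> and the uniform law.
\<close>

definition discrepancy :: "(nat \<Rightarrow> 'a) set \<Rightarrow> nat \<Rightarrow> real" where
  "discrepancy E t = (\<Sum>l\<in>index_pairs t \<rightarrow>\<^sub>E carrier K.
     \<bar>card {a \<in> {1..t} \<rightarrow>\<^sub>E E. dist_colouring t a = l} / real (card E ^ t)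
       - 1 / real (q ^ card (index_pairs t))\<bar>)"

lemma dist_colouring_mem:
  assumes "E \<subseteq> vecs K d" "a \<in> {1..t} \<rightarrow>\<^sub>E E"
  shows "dist_colouring t a \<in> index_pairs t \<rightarrow>\<^sub>E carrier K"
proof -
  have "a i \<in> vecs K d" "a j \<in> vecs K d" if "(i, j) \<in> index_pairs t" for i j
    using that assms by (auto simp: index_pairs_def)
  then show ?thesis
    by (auto simp: dist_colouring_def qdist_closed)
qed

lemma dists_to_mem:
  assumes "E \<subseteq> vecs K d" "a \<in> {1..t} \<rightarrow>\<^sub>E E" "x \<in> E"
  shows "dists_to t a x \<in> {1..t} \<rightarrow>\<^sub>E carrier K"
proof -
  have "a i \<in> vecs K d" if "i \<in> {1..t}" for i using that assms by auto
  then show ?thesis using assms by (auto simp: dists_to_def qdist_closed subsetD)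
qed

text \<open>
  Cauchy-Schwarz turns the \<open>L\<^sup>1\<close> distance into a variance for each tuple \<open>a\<close>. Counting coincidences
  with \<open>x\<close> and \<open>y\<close> fixed, the coordinates of \<open>a\<close> can be chosen independently among the points
  equidistant from \<open>x\<close> and \<open>y\<close>, which gives the \<open>k\<close>-th power of the codegree.
\<close>

lemma sum_dists_to_discrepancy_le:
  assumes E: "E \<subseteq> vecs K d" "E \<noteq> {}"
  shows "(\<Sum>a\<in>{1..k} \<rightarrow>\<^sub>E E. \<Sum>m\<in>{1..k} \<rightarrow>\<^sub>E carrier K.
            \<bar>card {x \<in> E. dists_to k a x = m} / real (card E) - 1 / real (q ^ k)\<bar>)
       \<le> real (card E) ^ k * (2 * real k * sqrt (real (card (vecs K d)) * q ^ k) / card E)"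
proof -
  let ?e = "real (card E)" and ?v = "real (card (vecs K d))"
  let ?A = "{1..k} \<rightarrow>\<^sub>E E" and ?M = "{1..k} \<rightarrow>\<^sub>E carrier K"
  let ?z = "\<lambda>a m. card {x \<in> E. dists_to k a x = m} / ?e - 1 / real (q ^ k)"
  have fin: "finite E" using E(1) by (rule finite_subset_vecs)
  have e: "?e > 0" using fin E(2) by (simp add: card_gt_0_iff)
  have q: "real q > 0" using q_pos by simp
  have finM: "finite ?M" and finA: "finite ?A"
    by (simp_all add: finite_PiE finite_carrier fin)
  have cM: "card ?M = q ^ k" and cA: "card ?A = card E ^ k"
    by (simp_all add: card_funcsetE)
  have agree: "{a \<in> ?A. dists_to k a x = dists_to k a y} = {1..k} \<rightarrow>\<^sub>E {a \<in> E. qdist a x = qdist a y}"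
    for x y
  proof -
    have "dists_to k a x = dists_to k a y \<longleftrightarrow> (\<forall>i\<in>{1..k}. qdist (a i) x = qdist (a i) y)" for a
      unfolding dists_to_def fun_eq_iff restrict_def by meson
    then show ?thesis by (auto simp: PiE_iff extensional_def)
  qed
  have "(\<Sum>a\<in>?A. \<Sum>m\<in>?M. (?z a m)\<^sup>2)
      = (\<Sum>a\<in>?A. (\<Sum>m\<in>?M. (real (card {x \<in> E. dists_to k a x = m}) - ?e / card ?M)\<^sup>2) / ?e\<^sup>2)"
    unfolding cM using e by (simp add: sum_divide_distrib diff_divide_distrib flip: power_divide)
  also have "\<dots> = (\<Sum>a\<in>?A. (real (\<Sum>x\<in>E. card {y \<in> E. dists_to k a x = dists_to k a y})
        - ?e\<^sup>2 / q ^ k) / ?e\<^sup>2)"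
  proof (rule sum.cong[OF refl])
    fix a assume "a \<in> ?A"
    then have "dists_to k a ` E \<subseteq> ?M" using E dists_to_mem by blast
    from fibre_variance[OF fin finM this, unfolded cM]
    show "(\<Sum>m\<in>?M. (real (card {x \<in> E. dists_to k a x = m}) - ?e / card ?M)\<^sup>2) / ?e\<^sup>2
        = (real (\<Sum>x\<in>E. card {y \<in> E. dists_to k a x = dists_to k a y}) - ?e\<^sup>2 / q ^ k) / ?e\<^sup>2"
      unfolding cM by simp
  qed
  also have "\<dots> = ((\<Sum>a\<in>?A. \<Sum>x\<in>E. \<Sum>y\<in>E. of_bool (dists_to k a x = dists_to k a y))
        - ?e ^ k * (?e\<^sup>2 / q ^ k)) / ?e\<^sup>2"
    using fin by (simp add: of_bool_def sum.If_cases Int_def sum_subtractf cA[simplified] flip: sum_divide_distrib)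
  also have "(\<Sum>a\<in>?A. \<Sum>x\<in>E. \<Sum>y\<in>E. of_bool (dists_to k a x = dists_to k a y))
      = (\<Sum>x\<in>E. \<Sum>y\<in>E. \<Sum>a\<in>?A. of_bool (dists_to k a x = dists_to k a y) :: real)"
    by (subst sum.swap, rule sum.cong[OF refl], subst sum.swap) rule
  also have "\<dots> = (\<Sum>x\<in>E. \<Sum>y\<in>E. real (card {a \<in> ?A. dists_to k a x = dists_to k a y}))"
    using finA by (simp add: of_bool_def sum.If_cases Int_def)
  also have "\<dots> = (\<Sum>x\<in>E. \<Sum>y\<in>E. real (codegree E x y) ^ k)"
    by (simp only: agree) (simp add: card_funcsetE codegree_def)
  also have "((\<Sum>x\<in>E. \<Sum>y\<in>E. real (codegree E x y) ^ k) - ?e ^ k * (?e\<^sup>2 / q ^ k)) / ?e\<^sup>2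
      \<le> ?e ^ k * (2 * k\<^sup>2 * ?v) / ?e\<^sup>2"
    using sum_codegree_power_le[OF E, of k] by (intro divide_right_mono) (auto simp: algebra_simps)
  finally have sq: "(\<Sum>a\<in>?A. \<Sum>m\<in>?M. (?z a m)\<^sup>2) \<le> ?e ^ k * (2 * k\<^sup>2 * ?v) / ?e\<^sup>2" .
  have "(\<Sum>a\<in>?A. \<Sum>m\<in>?M. \<bar>?z a m\<bar>)\<^sup>2 = (\<Sum>p\<in>?A \<times> ?M. \<bar>?z (fst p) (snd p)\<bar>)\<^sup>2"
    by (simp add: sum.cartesian_product case_prod_beta)
  also have "\<dots> \<le> (\<Sum>p\<in>?A \<times> ?M. \<bar>?z (fst p) (snd p)\<bar>\<^sup>2) * card (?A \<times> ?M)"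
    by (rule sum_squared_le_sum_of_squares)
  also have "\<dots> = (\<Sum>a\<in>?A. \<Sum>m\<in>?M. (?z a m)\<^sup>2) * (?e ^ k * q ^ k)"
    unfolding card_cartesian_product cA cM by (simp add: sum.cartesian_product case_prod_beta)
  also have "\<dots> \<le> (?e ^ k * (2 * k\<^sup>2 * ?v) / ?e\<^sup>2) * (?e ^ k * q ^ k)"
    using sq by (rule mult_right_mono) simp
  \<comment> \<open>Replacing 2 by 4 makes the bound a perfect square.\<close>
  also have "\<dots> \<le> (?e ^ k * (4 * k\<^sup>2 * ?v) / ?e\<^sup>2) * (?e ^ k * q ^ k)"
    by (intro mult_right_mono divide_right_mono mult_left_mono) auto
  also have "\<dots> = (?e ^ k * (2 * real k * sqrt (?v * q ^ k) / ?e))\<^sup>2"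
    using q by (simp add: power_mult_distrib power_divide field_simps flip: power2_eq_square)
  finally show ?thesis
    by (rule power2_le_imp_le) simp
qed

section \<open>Adding one point\<close>

lemma discrepancy_0: "discrepancy E 0 = 0"
proof -
  have "{a. a = (\<lambda>_. undefined) \<and> dist_colouring 0 a = (\<lambda>_. undefined)} = {\<lambda>_. undefined}"
    by (auto simp: dist_colouring_def index_pairs_0)
  then show ?thesis by (simp add: discrepancy_def index_pairs_0)
qed

definition extend_colouring :: "nat \<Rightarrow> (nat \<times> nat \<Rightarrow> 'a) \<Rightarrow> (nat \<Rightarrow> 'a) \<Rightarrow> nat \<times> nat \<Rightarrow> 'a" where
  "extend_colouring t l m =
     (\<lambda>(i, j)\<in>index_pairs (Suc t). if j = Suc t then m i else l (i, j))"

lemma extend_colouring_bij: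
  "bij_betw (\<lambda>(l, m). extend_colouring t l m)
     ((index_pairs t \<rightarrow>\<^sub>E carrier K) \<times> ({1..t} \<rightarrow>\<^sub>E carrier K))
     (index_pairs (Suc t) \<rightarrow>\<^sub>E carrier K)"
proof (rule bij_betw_byWitness[where f' = "\<lambda>l. (restrict l (index_pairs t), \<lambda>i\<in>{1..t}. l (i, Suc t))"])
  have last: "(i, Suc t) \<in> index_pairs (Suc t) \<longleftrightarrow> i \<in> {1..t}" for i
    by (auto simp: index_pairs_def)
  have old: "(i, j) \<in> index_pairs (Suc t)" "j \<noteq> Suc t" if "(i, j) \<in> index_pairs t" for i j
    using that by (auto simp: index_pairs_def)
  have old': "(i, j) \<in> index_pairs t" if "(i, j) \<in> index_pairs (Suc t)" "j \<noteq> Suc t" for i j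
    using that by (auto simp: index_pairs_def)
  show "\<forall>p\<in>(index_pairs t \<rightarrow>\<^sub>E carrier K) \<times> ({1..t} \<rightarrow>\<^sub>E carrier K).
      (restrict (case p of (l, m) \<Rightarrow> extend_colouring t l m) (index_pairs t),
       \<lambda>i\<in>{1..t}. (case p of (l, m) \<Rightarrow> extend_colouring t l m) (i, Suc t)) = p"
  proof
    fix p assume "p \<in> (index_pairs t \<rightarrow>\<^sub>E carrier K) \<times> ({1..t} \<rightarrow>\<^sub>E carrier K)"
    then obtain l m where p: "p = (l, m)"
      and l: "l \<in> index_pairs t \<rightarrow>\<^sub>E carrier K" and m: "m \<in> {1..t} \<rightarrow>\<^sub>E carrier K"
      by blast
    have "restrict (extend_colouring t l m) (index_pairs t) = l"
    proof (rule extensionalityI[of _ "index_pairs t"])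
      fix p assume "p \<in> index_pairs t"
      then show "restrict (extend_colouring t l m) (index_pairs t) p = l p"
        by (cases p) (simp add: extend_colouring_def old)
    qed (use l in \<open>auto simp: PiE_def\<close>)
    moreover have "(\<lambda>i\<in>{1..t}. extend_colouring t l m (i, Suc t)) = m"
    proof (rule extensionalityI[of _ "{1..t}"])
      fix i assume "i \<in> {1..t}"
      then show "(\<lambda>i\<in>{1..t}. extend_colouring t l m (i, Suc t)) i = m i"
        using last by (simp add: extend_colouring_def)
    qed (use m in \<open>auto simp: PiE_def\<close>)
    ultimately show "(restrict (case p of (l, m) \<Rightarrow> extend_colouring t l m) (index_pairs t),
       \<lambda>i\<in>{1..t}. (case p of (l, m) \<Rightarrow> extend_colouring t l m) (i, Suc t)) = p"
      by (simp add: p)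
  qed
  show "\<forall>l\<in>index_pairs (Suc t) \<rightarrow>\<^sub>E carrier K.
      (case (restrict l (index_pairs t), \<lambda>i\<in>{1..t}. l (i, Suc t)) of (l, m) \<Rightarrow> extend_colouring t l m) = l"
  proof
    fix l assume l: "l \<in> index_pairs (Suc t) \<rightarrow>\<^sub>E carrier K"
    show "(case (restrict l (index_pairs t), \<lambda>i\<in>{1..t}. l (i, Suc t)) of (l, m) \<Rightarrow> extend_colouring t l m) = l"
    proof (rule extensionalityI[of _ "index_pairs (Suc t)"])
      fix p assume "p \<in> index_pairs (Suc t)"
      then show "(case (restrict l (index_pairs t), \<lambda>i\<in>{1..t}. l (i, Suc t)) of (l, m) \<Rightarrow> extend_colouring t l m) p = l p"
        using last old' by (cases p) (auto simp: extend_colouring_def)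
    qed (use l in \<open>auto simp: PiE_def extend_colouring_def\<close>)
  qed
  show "(\<lambda>(l, m). extend_colouring t l m) ` ((index_pairs t \<rightarrow>\<^sub>E carrier K) \<times> ({1..t} \<rightarrow>\<^sub>E carrier K))
      \<subseteq> index_pairs (Suc t) \<rightarrow>\<^sub>E carrier K"
  proof clarify
    fix l m assume l: "l \<in> index_pairs t \<rightarrow>\<^sub>E carrier K" and m: "m \<in> {1..t} \<rightarrow>\<^sub>E carrier K"
    show "extend_colouring t l m \<in> index_pairs (Suc t) \<rightarrow>\<^sub>E carrier K"
      unfolding extend_colouring_def
      by (intro restrict_PiE_iff[THEN iffD2] ballI)
        (use PiE_mem[OF l] PiE_mem[OF m] last old' in \<open>auto split: if_splits\<close>)
  qed
  show "(\<lambda>l. (restrict l (index_pairs t), \<lambda>i\<in>{1..t}. l (i, Suc t))) ` (index_pairs (Suc t) \<rightarrow>\<^sub>E carrier K)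
      \<subseteq> (index_pairs t \<rightarrow>\<^sub>E carrier K) \<times> ({1..t} \<rightarrow>\<^sub>E carrier K)"
  proof clarify
    fix l assume l: "l \<in> index_pairs (Suc t) \<rightarrow>\<^sub>E carrier K"
    have "l p \<in> carrier K" if "p \<in> index_pairs t" for p
      using l that by (auto simp: index_pairs_Suc)
    moreover have "l (i, Suc t) \<in> carrier K" if "i \<in> {1..t}" for i
      using l that by (auto simp: index_pairs_Suc)
    ultimately show "restrict l (index_pairs t) \<in> index_pairs t \<rightarrow>\<^sub>E carrier K \<and>
        (\<lambda>i\<in>{1..t}. l (i, Suc t)) \<in> {1..t} \<rightarrow>\<^sub>E carrier K"
      by auto
  qed
qed

lemma dist_colouring_fun_upd:
  "dist_colouring (Suc t) (a(Suc t := x)) = extend_colouring t (dist_colouring t a) (dists_to t a x)"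
  by (rule extensionalityI[of _ "index_pairs (Suc t)"])
    (auto simp: dist_colouring_def dists_to_def extend_colouring_def, auto simp: index_pairs_def)

text \<open>
  Splitting off the last point of a tuple splits off the last column of its colouring.
\<close>

lemma card_colouring_extend:
  assumes E: "E \<subseteq> vecs K d"
    and l: "l \<in> index_pairs t \<rightarrow>\<^sub>E carrier K" and m: "m \<in> {1..t} \<rightarrow>\<^sub>E carrier K"
  shows "card {a \<in> {1..Suc t} \<rightarrow>\<^sub>E E. dist_colouring (Suc t) a = extend_colouring t l m}
       = card {(a, x) \<in> ({1..t} \<rightarrow>\<^sub>E E) \<times> E. dist_colouring t a = l \<and> dists_to t a x = m}"
    (is "card ?S = card ?T")
proof -
  let ?h = "\<lambda>(x, a). a(Suc t := x)"
  have ins: "{1..Suc t} = insert (Suc t) {1..t}" by auto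
  have bij: "bij_betw ?h (E \<times> ({1..t} \<rightarrow>\<^sub>E E)) ({1..Suc t} \<rightarrow>\<^sub>E E)"
    unfolding ins PiE_insert_eq by (rule inj_on_imp_bij_betw[OF inj_combinator]) simp
  have eq: "dist_colouring (Suc t) (a(Suc t := x)) = extend_colouring t l m
      \<longleftrightarrow> dist_colouring t a = l \<and> dists_to t a x = m"
    if "x \<in> E" "a \<in> {1..t} \<rightarrow>\<^sub>E E" for x a
    using bij_betw_imp_inj_on[OF extend_colouring_bij[of t]] l m
      dist_colouring_mem[OF E that(2)] dists_to_mem[OF E that(2,1)]
    unfolding dist_colouring_fun_upd inj_on_def by fastforce
  have "?S = ?h ` {(x, a) \<in> E \<times> ({1..t} \<rightarrow>\<^sub>E E). dist_colouring t a = l \<and> dists_to t a x = m}"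
    using eq unfolding bij_betw_imp_surj_on[OF bij, symmetric] by auto
  moreover have "inj_on ?h {(x, a) \<in> E \<times> ({1..t} \<rightarrow>\<^sub>E E). dist_colouring t a = l \<and> dists_to t a x = m}"
    by (rule inj_on_subset[OF bij_betw_imp_inj_on[OF bij]]) auto
  ultimately have "card ?S
      = card {(x, a) \<in> E \<times> ({1..t} \<rightarrow>\<^sub>E E). dist_colouring t a = l \<and> dists_to t a x = m}"
    by (simp only: card_image)
  also have "\<dots> = card (prod.swap ` ?T)"
    by (rule arg_cong[where f = card]) (auto simp: image_iff)
  also have "\<dots> = card ?T" by (rule card_image) simp
  finally show ?thesis .
qed

lemma discrepancy_Suc_le:
  assumes E: "E \<subseteq> vecs K d" "E \<noteq> {}"
  shows "discrepancy E (Suc t)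
       \<le> discrepancy E t + 2 * real t * sqrt (real (card (vecs K d)) * q ^ t) / card E"
proof -
  let ?L = "index_pairs t \<rightarrow>\<^sub>E carrier K" and ?M = "{1..t} \<rightarrow>\<^sub>E carrier K"
  let ?X = "{1..t} \<rightarrow>\<^sub>E E"
  have fin: "finite E" using E(1) by (rule finite_subset_vecs)
  have e: "real (card E) > 0" using fin E(2) by (simp add: card_gt_0_iff)
  have cL: "card ?L = q ^ card (index_pairs t)" and cM: "card ?M = q ^ t"
    and cX: "card ?X = card E ^ t"
    by (simp_all add: card_funcsetE finite_index_pairs)
  have "discrepancy E (Suc t) = (\<Sum>(l, m)\<in>?L \<times> ?M.
      \<bar>card {a \<in> {1..Suc t} \<rightarrow>\<^sub>E E. dist_colouring (Suc t) a = extend_colouring t l m} / real (card E ^ Suc t)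
        - 1 / real (q ^ card (index_pairs (Suc t)))\<bar>)"
    unfolding discrepancy_def
    by (subst sum.reindex_bij_betw[OF extend_colouring_bij, symmetric]) (simp add: case_prod_beta)
  also have "\<dots> = (\<Sum>(l, m)\<in>?L \<times> ?M.
      \<bar>card {(a, x) \<in> ?X \<times> E. dist_colouring t a = l \<and> dists_to t a x = m} / (real (card ?X) * card E)
        - 1 / (real (card ?L) * card ?M)\<bar>)"
  proof (intro sum.cong refl, clarify)
    fix l m assume lm: "l \<in> ?L" "m \<in> ?M"
    show "\<bar>card {a \<in> {1..Suc t} \<rightarrow>\<^sub>E E. dist_colouring (Suc t) a = extend_colouring t l m} / real (card E ^ Suc t)
        - 1 / real (q ^ card (index_pairs (Suc t)))\<bar>
      = \<bar>card {(a, x) \<in> ?X \<times> E. dist_colouring t a = l \<and> dists_to t a x = m} / (real (card ?X) * card E)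
        - 1 / (real (card ?L) * card ?M)\<bar>"
      unfolding card_colouring_extend[OF E(1) lm] cL cM cX card_index_pairs_Suc
      by (simp add: power_add mult_ac)
  qed
  also have "\<dots> \<le> (\<Sum>l\<in>?L. \<bar>card {a \<in> ?X. dist_colouring t a = l} / card ?X - 1 / card ?L\<bar>)
      + (\<Sum>a\<in>?X. \<Sum>m\<in>?M. \<bar>card {x \<in> E. dists_to t a x = m} / card E - 1 / card ?M\<bar>) / card ?X"
    by (rule L1_discrepancy_chain)
      (use dist_colouring_mem[OF E(1)] in \<open>auto simp: finite_PiE fin finite_carrier finite_index_pairs\<close>)
  also have "(\<Sum>l\<in>?L. \<bar>card {a \<in> ?X. dist_colouring t a = l} / card ?X - 1 / card ?L\<bar>) = discrepancy E t"
    unfolding discrepancy_def cX cL by simp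
  also have "(\<Sum>a\<in>?X. \<Sum>m\<in>?M. \<bar>card {x \<in> E. dists_to t a x = m} / card E - 1 / card ?M\<bar>) / card ?X
      \<le> real (card E) ^ t * (2 * real t * sqrt (real (card (vecs K d)) * q ^ t) / card E) / card ?X"
    unfolding cM by (rule divide_right_mono[OF sum_dists_to_discrepancy_le[OF E]]) simp
  also have "\<dots> = 2 * real t * sqrt (real (card (vecs K d)) * q ^ t) / card E"
    unfolding cX using e by simp
  finally show ?thesis by simp
qed

text \<open>
  The last step of the chain dominates, so all \<open>t\<close> steps are estimated by it.
\<close>

lemma discrepancy_le:
  assumes E: "E \<subseteq> vecs K d" "E \<noteq> {}"
  shows "discrepancy E t \<le> 2 * (real t)\<^sup>2 * sqrt (real (card (vecs K d)) * q ^ (t - 1)) / card E"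
proof -
  let ?b = "\<lambda>k. 2 * real k * sqrt (real (card (vecs K d)) * q ^ k) / card E"
  have "discrepancy E t \<le> (\<Sum>k<t. ?b k)"
  proof (induction t)
    case (Suc t)
    then show ?case using discrepancy_Suc_le[OF E, of t] by simp
  qed (simp add: discrepancy_0)
  also have "\<dots> \<le> (\<Sum>k<t. 2 * real t * sqrt (real (card (vecs K d)) * q ^ (t - 1)) / card E)"
    using q_pos by (intro sum_mono divide_right_mono mult_mono real_sqrt_le_mono mult_left_mono)
      (auto intro!: power_increasing)
  finally show ?thesis by (simp add: power2_eq_square mult_ac)
qed

lemma solvable_iff:
  assumes "l \<in> index_pairs t \<rightarrow>\<^sub>E carrier K"
  shows "solvable K d t Q E l \<longleftrightarrow> (\<exists>a\<in>{1..t} \<rightarrow>\<^sub>E E. dist_colouring t a = l)"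
proof
  assume "solvable K d t Q E l"
  then obtain a where a: "\<And>i. i \<in> {1..t} \<Longrightarrow> a i \<in> E"
    and al: "\<And>i j. (i, j) \<in> index_pairs t \<Longrightarrow> qdist (a i) (a j) = l (i, j)"
    unfolding solvable_def by blast
  have "dist_colouring t (restrict a {1..t}) = l"
  proof (rule extensionalityI[of _ "index_pairs t"])
    fix p assume "p \<in> index_pairs t"
    then show "dist_colouring t (restrict a {1..t}) p = l p"
      using al by (cases p) (auto simp: dist_colouring_def index_pairs_def)
  qed (use assms in \<open>auto simp: dist_colouring_def PiE_def\<close>)
  then show "\<exists>a\<in>{1..t} \<rightarrow>\<^sub>E E. dist_colouring t a = l"
    using a by (intro bexI[of _ "restrict a {1..t}"]) auto
next
  assume "\<exists>a\<in>{1..t} \<rightarrow>\<^sub>E E. dist_colouring t a = l"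
  then obtain a where a: "a \<in> {1..t} \<rightarrow>\<^sub>E E" and l: "l = dist_colouring t a" by blast
  show "solvable K d t Q E l"
    unfolding solvable_def l
    by (rule exI[of _ a]) (use a in \<open>auto simp: dist_colouring_def\<close>)
qed

text \<open>
  A quantitative form, valid for every field size: the \<open>L\<^sup>1\<close> distance is at least the uniform weight of
  the colourings that do not occur.
\<close>

theorem card_solvable_systems_ge:
  assumes E: "E \<subseteq> vecs K d" "E \<noteq> {}"
  shows "real (card (solvable_systems K d t Q E))
       \<ge> (1 - 2 * (real t)\<^sup>2 * sqrt (real (card (vecs K d)) * q ^ (t - 1)) / card E) * real q ^ (t choose 2)"
proof -
  let ?L = "index_pairs t \<rightarrow>\<^sub>E carrier K" and ?S = "solvable_systems K d t Q E"
  let ?N = "real (q ^ (t choose 2))"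
  have finL: "finite ?L" by (simp add: finite_PiE finite_index_pairs finite_carrier)
  have cL: "card ?L = q ^ (t choose 2)" by (simp add: card_funcsetE finite_index_pairs card_index_pairs)
  have S: "?S \<subseteq> ?L" by (auto simp: solvable_systems_def)
  have N: "?N > 0" using q_pos by simp
  have "card (?L - ?S) / ?N = (\<Sum>l\<in>?L - ?S. 1 / ?N)" by simp
  also have "\<dots> = (\<Sum>l\<in>?L - ?S.
      \<bar>card {a \<in> {1..t} \<rightarrow>\<^sub>E E. dist_colouring t a = l} / real (card E ^ t) - 1 / ?N\<bar>)"
  proof (rule sum.cong[OF refl])
    fix l assume "l \<in> ?L - ?S"
    then have "{a \<in> {1..t} \<rightarrow>\<^sub>E E. dist_colouring t a = l} = {}"
      by (auto simp: solvable_systems_def solvable_iff)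
    then show "1 / ?N = \<bar>card {a \<in> {1..t} \<rightarrow>\<^sub>E E. dist_colouring t a = l} / real (card E ^ t) - 1 / ?N\<bar>"
      by (simp only:) simp
  qed
  also have "\<dots> \<le> discrepancy E t"
    unfolding discrepancy_def card_index_pairs by (rule sum_mono2[OF finL]) auto
  also have "\<dots> \<le> 2 * (real t)\<^sup>2 * sqrt (real (card (vecs K d)) * q ^ (t - 1)) / card E"
    by (rule discrepancy_le[OF E])
  finally have "real (card (?L - ?S))
      \<le> (2 * (real t)\<^sup>2 * sqrt (real (card (vecs K d)) * q ^ (t - 1)) / card E) * ?N"
    using N by (simp only: pos_divide_le_eq)
  moreover have "real (card (?L - ?S)) = ?N - card ?S"
    using card_Diff_subset[OF finite_subset[OF S finL] S] card_mono[OF finL S] cL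
    by (simp add: of_nat_diff)
  ultimately show ?thesis by (simp add: left_diff_distrib)
qed

end

section \<open>The asymptotic statement\<close>

theorem theorem2p25:
  fixes d t :: nat
    and F :: "'i filter"
    and K :: "'i \<Rightarrow> 'a ring"
    and q :: "'i \<Rightarrow> nat"
    and Q :: "'i \<Rightarrow> (nat \<Rightarrow> 'a) \<Rightarrow> 'a"
    and E :: "'i \<Rightarrow> (nat \<Rightarrow> 'a) set"
  assumes "d \<ge> 2" and "t \<ge> 2"
    and "\<And>n. field (K n)"
    and "\<And>n. q n = card (carrier (K n))"
    and "\<And>n. \<exists>p m. prime p \<and> odd p \<and> m > 0 \<and> q n = p ^ m"
    and "filterlim q at_top F"
    and "\<And>n. nondegenerate_quadratic_form (K n) d (Q n)"
    and "\<And>n. E n \<subseteq> vecs (K n) d"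
    and "(\<lambda>n. real (q n) powr ((real d + real t - 1) / 2)) \<in> o[F](\<lambda>n. real (card (E n)))"
  shows "\<exists>\<delta> :: 'i \<Rightarrow> real. (\<delta> \<longlongrightarrow> 0) F \<and>
    (\<forall>n. real (card (solvable_systems (K n) d t (Q n) (E n)))
          \<ge> (1 - \<delta> n) * real (q n) ^ (t choose 2))"
proof -
  have order_pos: "q n > 0" for n
    using assms(5)[of n] by (auto simp: prime_gt_0_nat)
  have space: "finite_quadratic_space (K n) d (Q n)" for n
  proof -
    have "finite (carrier (K n))"
      using order_pos[of n] unfolding assms(4) by (rule card_ge_0_finite)
    then show ?thesis
      using assms(3,7) by (simp add: finite_quadratic_space_def finite_quadratic_space_axioms_def)
  qed
  let ?p = "\<lambda>n. real (q n) powr ((real d + real t - 1) / 2)"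
  \<comment> \<open>For empty \<open>E n\<close> the quotient would be the default value 0, which is not a valid bound.\<close>
  define \<delta> where "\<delta> n = (if E n = {} then 1 else 2 * (real t)\<^sup>2 * (?p n / card (E n)))" for n
  have "eventually (\<lambda>n. \<bar>?p n\<bar> \<le> 1 * \<bar>real (card (E n))\<bar>) F"
    using landau_o.smallD[OF assms(9), of 1] by simp
  then have nonempty: "eventually (\<lambda>n. E n \<noteq> {}) F"
  proof (rule eventually_mono)
    fix n assume "\<bar>?p n\<bar> \<le> 1 * \<bar>real (card (E n))\<bar>"
    moreover have "?p n > 0" using order_pos[of n] by simp
    ultimately show "E n \<noteq> {}" by auto
  qed
  have "((\<lambda>n. 2 * (real t)\<^sup>2 * (?p n / card (E n))) \<longlongrightarrow> 2 * (real t)\<^sup>2 * 0) F"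
    by (intro tendsto_mult_left smalloD_tendsto assms(9))
  then have lim: "((\<lambda>n. 2 * (real t)\<^sup>2 * (?p n / card (E n))) \<longlongrightarrow> 0) F"
    by simp
  have "(\<delta> \<longlongrightarrow> 0) F"
    by (rule Lim_transform_eventually[OF lim])
      (use nonempty in \<open>auto simp: \<delta>_def elim!: eventually_mono\<close>)
  moreover have "real (card (solvable_systems (K n) d t (Q n) (E n))) \<ge> (1 - \<delta> n) * real (q n) ^ (t choose 2)" for n
  proof (cases "E n = {}")
    case False
    interpret finite_quadratic_space "K n" d "Q n" by (rule space)
    have "sqrt (real (card (vecs (K n) d)) * q n ^ (t - 1)) = sqrt (real (q n) ^ (d + (t - 1)))"
      by (simp add: card_vecs assms(4) power_add)
    also have "\<dots> = (real (q n) powr real (d + (t - 1))) powr (1 / 2)"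
      using order_pos[of n] by (simp add: powr_realpow powr_half_sqrt del: of_nat_add)
    also have "\<dots> = ?p n"
      using assms(2) by (simp add: powr_powr of_nat_diff add_divide_distrib diff_divide_distrib)
    finally have "2 * (real t)\<^sup>2 * sqrt (real (card (vecs (K n) d)) * q n ^ (t - 1)) / card (E n) = \<delta> n"
      using False by (simp add: \<delta>_def)
    then show ?thesis
      using card_solvable_systems_ge[OF assms(8) False, where t = t] unfolding assms(4)[symmetric] by simp
  qed (simp add: \<delta>_def)
  ultimately show ?thesis by blast
qed

end
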